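(* Let $n\ge 0$ be an integer. Then $$\sum_{k=0}^{2n+1}\binom{2n+1}{k}\Bigl(\prod_{j=1}^{2n+1}(6n-2k+4-2j)\Bigr)(-1)^k\,3^{2k+1}+\sum_{k=0}^{2n+1}\binom{2n+1}{k}\Bigl(\prod_{j=1}^{2n+1}(6n-2k+5-2j)\Bigr)(-1)^k\,3^{2k}=0.$$
   Context: The identity is between integers; the factors in the products may be negative or zero. *)

theory Defs
  imports Complex_Main
begin

end

theory Submission
  imports Defs "HOL-Computational_Algebra.Formal_Power_Series"
begin

text \<open>
  Put \<open>m = 2n + 1\<close>. After division by \<open>2\<^sup>m m!\<close> the products become generalised binomial
  coefficients, and the two sums together become the coefficient of \<open>t\<^sup>m\<close> in
  \<open>(1 + t)\<^sup>n (t - 8)\<^sup>m (3 + sqrt (1 + t))\<close>, that is, a residue at \<open>t = 0\<close>. With \<open>s = sqrt (1 + t)\<close>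
  the differential form is, up to a constant, \<open>g\<^sup>m \<omega>\<close> for \<open>g = s (s\<^sup>2 - 9) / (s\<^sup>2 - 1)\<close> and
  \<open>\<omega> = (s + 3) ds / (s\<^sup>2 - 1)\<close>. The involution \<open>s \<mapsto> (3 - s) / (1 + s)\<close> fixes \<open>s = 1\<close>, preserves
  \<open>\<omega>\<close> and negates \<open>g\<close>; as \<open>m\<close> is odd, the residue vanishes.
\<close>

unbundle fps_syntax

text \<open>With \<open>T = fps_X * U\<close> this coefficient is the residue of
  \<open>dT / T ^ (p + 1)\<close>. For \<open>p > 0\<close> the form is exact, hence residue 0; for
  \<open>p = 0\<close> it is the logarithmic derivative of a series with a simple zero.\<close>

lemma fps_nth_deriv_change_of_variables:
  fixes U W :: "'a::field_char_0 fps"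
  assumes UW: "U * W = 1"
  shows "(fps_deriv (fps_X * U) * W ^ Suc p) $ p = (if p = 0 then 1 else 0)"
proof (cases p)
  case 0
  have "(U * W) $ 0 = 1" using UW by simp
  with 0 show ?thesis by simp
next
  case (Suc q)
  have "fps_deriv (U * W) = 0" unfolding UW by simp
  hence "U * fps_deriv W + fps_deriv U * W = 0" by simp
  hence W': "fps_deriv W = - (fps_deriv U * W\<^sup>2)"
    using UW by algebra
  have "fps_deriv (W ^ p) = of_nat p * fps_deriv W * W ^ q"
    unfolding fps_deriv_power' using Suc by simp
  also have "\<dots> = - of_nat p * fps_deriv U * W ^ Suc p"
    by (simp add: W' Suc power2_eq_square algebra_simps)
  finally have dW: "fps_deriv (W ^ p) = - of_nat p * fps_deriv U * W ^ Suc p" .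
  have "fps_deriv (fps_X * U) * W ^ Suc p
      = (U * W) * W ^ p + fps_X * fps_deriv U * W ^ Suc p"
    by (simp add: algebra_simps)
  \<comment> \<open>The Euler operator \<open>f \<mapsto> fps_X * fps_deriv f\<close> multiplies the
    coefficient at \<open>p\<close> by \<open>p\<close>, so the right-hand side has coefficient 0
    there.\<close>
  hence "of_nat p * (fps_deriv (fps_X * U) * W ^ Suc p)
      = of_nat p * W ^ p - fps_X * fps_deriv (W ^ p)"
    by (simp add: UW dW algebra_simps)
  hence "(of_nat p * (fps_deriv (fps_X * U) * W ^ Suc p)) $ p
      = (of_nat p * W ^ p - fps_X * fps_deriv (W ^ p)) $ p"
    by (rule arg_cong)
  hence "of_nat p * (fps_deriv (fps_X * U) * W ^ Suc p) $ p = 0"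
    using Suc by (simp del: power_Suc fps_deriv_mult add: fps_of_nat[symmetric])
  moreover have "of_nat p \<noteq> (0 :: 'a)" using Suc by (simp only: of_nat_eq_0_iff)
  ultimately show ?thesis using Suc by simp
qed

text \<open>
  The formal version of the invariance of the residue of \<open>A dt / t\<^sup>m\<^sup>+\<^sup>1\<close>
  under the change of variables \<open>t = w U(w)\<close>.
\<close>

lemma fps_nth_change_of_variables:
  fixes A U W :: "'a::field_char_0 fps"
  assumes UW: "U * W = 1"
  shows "A $ m = ((A oo fps_X * U) * fps_deriv (fps_X * U) * W ^ Suc m) $ m"
proof -
  define T where "T = fps_X * U"
  have T0: "T $ 0 = 0" by (simp add: T_def)
  have TW: "T ^ k * W ^ k = fps_X ^ k" for k
    using UW by (simp add: T_def flip: power_mult_distrib) (simp add: mult.assoc)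
  \<comment> \<open>The tail \<open>R\<close> enters with \<open>T ^ Suc m\<close>, which
    \<open>W ^ Suc m\<close> turns into \<open>fps_X ^ Suc m\<close>, beyond coefficient
    \<open>m\<close>. Each monomial of \<open>P\<close> reduces to the preceding lemma with
    \<open>p = m - k\<close>.\<close>
  define P where "P = (\<Sum>k\<le>m. fps_const (A $ k) * fps_X ^ k)"
  define R where "R = fps_shift (Suc m) A"
  have A: "A = P + fps_X ^ Suc m * R"
    by (rule fps_ext)
      (auto simp: P_def R_def fps_sum_nth fps_X_power_mult_nth if_distrib if_distribR
         not_less_eq sum.delta cong: if_cong simp del: power_Suc)
  have XT: "fps_X oo T = T" using T0 by simp
  have PT: "P oo T = (\<Sum>k\<le>m. fps_const (A $ k) * T ^ k)"
    by (simp add: P_def fps_compose_sum_distrib fps_compose_mult_distrib T0 XT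
        flip: fps_compose_power)
  have "A oo T = (P oo T) + T ^ Suc m * (R oo T)"
    by (subst A) (simp add: fps_compose_add_distrib fps_compose_mult_distrib T0 XT
        del: power_Suc flip: fps_compose_power)
  hence "(A oo T) * fps_deriv T * W ^ Suc m
      = (P oo T) * fps_deriv T * W ^ Suc m + (T ^ Suc m * W ^ Suc m) * ((R oo T) * fps_deriv T)"
    by (simp add: algebra_simps del: power_Suc)
  hence "((A oo T) * fps_deriv T * W ^ Suc m) $ m = ((P oo T) * fps_deriv T * W ^ Suc m) $ m"
    unfolding TW by (simp add: fps_X_power_mult_nth del: power_Suc)
  also have "(P oo T) * fps_deriv T * W ^ Suc m
      = (\<Sum>k\<le>m. fps_const (A $ k) * (fps_X ^ k * (fps_deriv T * W ^ Suc (m - k))))"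
    unfolding PT sum_distrib_right
  proof (intro sum.cong refl)
    fix k assume "k \<in> {..m}"
    hence W: "W ^ Suc m = W ^ k * W ^ Suc (m - k)"
      by (simp flip: power_add)
    thus "fps_const (A $ k) * T ^ k * fps_deriv T * W ^ Suc m
        = fps_const (A $ k) * (fps_X ^ k * (fps_deriv T * W ^ Suc (m - k)))"
      by (simp only: TW[symmetric] W mult_ac)
  qed
  also have "\<dots> $ m = (\<Sum>k\<le>m. A $ k * (fps_deriv T * W ^ Suc (m - k)) $ (m - k))"
    unfolding fps_sum_nth
    by (intro sum.cong refl) (simp add: fps_X_power_mult_nth del: power_Suc)
  also have "\<dots> = (\<Sum>k\<le>m. A $ k * (if m - k = 0 then 1 else 0))"
    unfolding T_def fps_nth_deriv_change_of_variables[OF UW] ..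
  also have "\<dots> = (\<Sum>k\<le>m. if k = m then A $ k else 0)"
    by (intro sum.cong refl) auto
  also have "\<dots> = A $ m" by simp
  finally show ?thesis by (simp add: T_def)
qed

text \<open>Each generalised binomial is the coefficient of \<open>t ^ m\<close> in
  \<open>(1 + t)\<close> to the power \<open>x - k\<close>. Factoring out the power
  \<open>x - m\<close> leaves the natural exponents \<open>m - k\<close>, and the binomial theorem
  applies.\<close>

lemma sum_binomial_power_gbinomial:
  fixes x c :: "'a::field_char_0"
  shows "(\<Sum>k\<le>m. of_nat (m choose k) * c ^ k * ((x - of_nat k) gchoose m))
    = (fps_binomial (x - of_nat m) * (1 + fps_X + fps_const c) ^ m) $ m"
proof -
  have "fps_binomial (x - of_nat m) * (1 + fps_X + fps_const c) ^ m
      = fps_binomial (x - of_nat m) *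
          (\<Sum>k\<le>m. of_nat (m choose k) * fps_const c ^ k * (1 + fps_X) ^ (m - k))"
    by (subst add.commute) (simp only: binomial_ring)
  also have "\<dots> = (\<Sum>k\<le>m. fps_const (of_nat (m choose k) * c ^ k) * fps_binomial (x - of_nat k))"
    unfolding sum_distrib_left
  proof (intro sum.cong refl)
    fix k assume "k \<in> {..m}"
    hence "x - of_nat k = (x - of_nat m) + of_nat (m - k)" by (simp add: of_nat_diff)
    hence "fps_binomial (x - of_nat k)
        = fps_binomial (x - of_nat m) * (1 + fps_X) ^ (m - k)"
      by (simp only: fps_binomial_add_mult fps_binomial_of_nat)
    thus "fps_binomial (x - of_nat m)
          * (of_nat (m choose k) * fps_const c ^ k * (1 + fps_X) ^ (m - k))
        = fps_const (of_nat (m choose k) * c ^ k) * fps_binomial (x - of_nat k)"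
      by (simp add: mult_ac fps_of_nat flip: fps_const_mult fps_const_power)
  qed
  finally show ?thesis by (simp add: fps_sum_nth)
qed

lemma fps_nth_odd_eq_0_if_even:
  fixes f :: "'a::field_char_0 fps"
  assumes "f oo - fps_X = f" "odd m"
  shows "f $ m = 0"
proof -
  have "(f oo - fps_X) $ m = - f $ m"
    using \<open>odd m\<close> by (simp add: fps_compose_uminus')
  thus ?thesis using assms(1) by simp
qed

text \<open>
  The substitution is \<open>s = (1 + 3w) / (1 - w) = 4 / (1 - w) - 3\<close>, where \<open>w = (s - 1) / (s + 3)\<close> is a
  coordinate in which the involution is \<open>w \<mapsto> - w\<close>.
\<close>

lemma fps_sqrt_nth_eq_0:
  fixes n :: nat
  defines "m \<equiv> 2 * n + 1"
  shows "((1 + fps_X) ^ n * (fps_X - 8) ^ m * (3 + fps_binomial (1/2 :: real))) $ m = 0"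
    (is "?A $ m = 0")
proof -
  define X where "X = (fps_X :: real fps)"
  define V where "V = inverse (1 - X)"
  define Y where "Y = inverse (1 + X)"
  define c where "c = fps_const (1/8 :: real)"
  define s where "s = 4 * V - 3"
  \<comment> \<open>From \<open>s - 1 = 4 * X * V\<close> and
    \<open>s + 1 = 2 * (1 + X) * V\<close>, the product \<open>s\<^sup>2 - 1\<close> is
    \<open>X * U\<close>.\<close>
  define U where "U = 8 * (1 + X) * V\<^sup>2"
  define W where "W = c * (1 - X)\<^sup>2 * Y"
  define T where "T = X * U"
  have V: "V * (1 - X) = 1" unfolding V_def X_def by (rule inverse_mult_eq_1) simp
  have Y: "Y * (1 + X) = 1" unfolding Y_def X_def by (rule inverse_mult_eq_1) simp
  have c: "8 * c = 1" by (simp add: c_def numeral_fps_const)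
  have UW: "U * W = 1" unfolding U_def W_def using V Y c by algebra
  have T: "T = s\<^sup>2 - 1" unfolding T_def U_def s_def using V by algebra
  have V': "fps_deriv V = V\<^sup>2"
  proof -
    have "fps_deriv (V * (1 - X)) = 0" unfolding V by simp
    hence "fps_deriv V * (1 - X) = V" by (simp add: X_def)
    moreover have "fps_deriv V = (fps_deriv V * (1 - X)) * V" using V by (simp add: mult_ac)
    ultimately show ?thesis by (simp add: power2_eq_square)
  qed
  have "fps_deriv T = 2 * s * fps_deriv s"
    by (simp add: T power2_eq_square)
  also have "fps_deriv s = 4 * V\<^sup>2" by (simp add: s_def V' numeral_fps_const)
  finally have T': "fps_deriv T = 8 * s * V\<^sup>2" by simp
  have T0: "T $ 0 = 0" by (simp add: T_def X_def)
  have XT: "fps_X oo T = T" using T0 by simp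
  have s0: "s $ 0 = 1" by (simp add: s_def V_def X_def)
  define B where "B = fps_binomial (1/2 :: real) oo T"
  have "B\<^sup>2 = (fps_binomial (1/2) ^ 2) oo T"
    unfolding B_def by (rule fps_compose_power[OF T0])
  also have "\<dots> = 1 + T"
    by (simp add: fps_binomial_power fps_binomial_1 fps_compose_add_distrib XT)
  \<comment> \<open>Both are square roots of \<open>1 + T\<close>; their common constant term 1
    excludes \<open>B = - s\<close>.\<close>
  finally have "(B - s) * (B + s) = 0" by (simp add: T algebra_simps power2_eq_square)
  moreover have "(B + s) $ 0 \<noteq> 0" by (simp add: B_def s0)
  hence "B + s \<noteq> 0" by force
  ultimately have B: "B = s" by simp
  have AT: "?A oo T = (1 + T) ^ n * (T - 8) ^ m * (3 + s)"
    by (simp add: fps_compose_mult_distrib[OF T0] fps_compose_add_distrib fps_compose_sub_distrib XT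
        numeral_fps_const B_def[symmetric] B flip: fps_compose_power[OF T0])
  \<comment> \<open>\<open>D\<close> clears the denominators of \<open>H\<close> and is even, so
    evenness of \<open>H * D ^ Suc m\<close> passes to \<open>H\<close>.\<close>
  define D where "D = (1 - X) * (1 + X)"
  define H where "H = (?A oo T) * fps_deriv T * W ^ Suc m"
  have "H * D ^ Suc m = (1 + T) ^ n * (T - 8) ^ m * (4 * V) * (8 * s * V\<^sup>2) * (W * D) ^ Suc m"
    unfolding H_def AT T' by (simp add: s_def power_mult_distrib mult_ac)
  also have "W * D = c * (1 - X) ^ 3" unfolding W_def D_def using Y by algebra
  also have "(1 + T) ^ n = s ^ (2 * n)" by (simp add: T power_mult)
  \<comment> \<open>As \<open>m = 2 * n + 1\<close>, the \<open>s\<close> from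
    \<open>fps_deriv T\<close> completes \<open>s ^ (2 * n)\<close> to \<open>s ^ m\<close>.\<close>
  also have "s ^ (2 * n) * (T - 8) ^ m * (4 * V) * (8 * s * V\<^sup>2) * (c * (1 - X) ^ 3) ^ Suc m
      = 4 * (8 * c) * (V * (1 - X)) ^ 3 * (s * (T - 8) * (c * (1 - X) ^ 3)) ^ m"
    by (simp add: m_def power_mult_distrib mult_ac power2_eq_square power3_eq_cube)
  \<comment> \<open>Here \<open>T - 8 = (s - 3) * (s + 3)\<close>, and \<open>s\<close>,
    \<open>s - 3\<close>, \<open>s + 3\<close> are \<open>V\<close> times \<open>1 + 3 * X\<close>,
    \<open>2 * (3 * X - 1)\<close>, \<open>4\<close>. The zeros \<open>s = 0\<close> and
    \<open>s = 3\<close>, swapped by the involution, sit at \<open>X = -1/3\<close> and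
    \<open>X = 1/3\<close>.\<close>
  also have "s * (T - 8) * (c * (1 - X) ^ 3) = 9 * X\<^sup>2 - 1"
    unfolding T s_def using V c by algebra
  finally have HD: "H * D ^ Suc m = 4 * (9 * X\<^sup>2 - 1) ^ m"
    by (simp add: V c)
  have neg0: "(- fps_X :: real fps) $ 0 = 0" by simp
  have XX: "X oo - fps_X = - X" by (simp add: X_def)
  have "(H oo - fps_X) * D ^ Suc m = (H * D ^ Suc m) oo - fps_X"
    by (simp add: D_def fps_compose_mult_distrib[OF neg0] fps_compose_add_distrib
        fps_compose_sub_distrib XX mult_ac del: power_Suc flip: fps_compose_power[OF neg0])
  also have "\<dots> = H * D ^ Suc m"
    unfolding HD
    by (simp add: fps_compose_mult_distrib[OF neg0] fps_compose_sub_distrib XX numeral_fps_const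
        flip: fps_compose_power[OF neg0])
  finally have "(H oo - fps_X) * D ^ Suc m = H * D ^ Suc m" .
  moreover have "D $ 0 = 1" by (simp add: D_def X_def)
  hence "D \<noteq> 0" by force
  ultimately have "H oo - fps_X = H" by simp
  moreover have "odd m" by (simp add: m_def)
  ultimately have "H $ m = 0" by (rule fps_nth_odd_eq_0_if_even)
  thus ?thesis
    using fps_nth_change_of_variables[OF UW, of ?A m] by (simp add: H_def T_def X_def)
qed

lemma prod_even_step_eq_gbinomial:
  fixes y :: "'a::field_char_0"
  shows "(\<Prod>j = 1..m. 2 * (y + 1) - 2 * of_nat j) = 2 ^ m * fact m * (y gchoose m)"
proof -
  have "(\<Prod>j = 1..m. 2 * (y + 1) - 2 * of_nat j) = (\<Prod>i<m. 2 * (y - of_nat i))"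
    by (rule prod.reindex_bij_witness[of _ Suc "\<lambda>j. j - 1"]) (auto simp: of_nat_diff algebra_simps)
  also have "\<dots> = 2 ^ m * (\<Prod>i = 0..<m. y - of_nat i)"
    by (simp only: prod.distrib prod_constant card_lessThan atLeast0LessThan)
  finally show ?thesis by (simp add: gbinomial_mult_fact mult.assoc)
qed

theorem theorem1p2:
  fixes n :: nat
  shows "(\<Sum>k = 0..2 * n + 1. int ((2 * n + 1) choose k)
            * (\<Prod>j = 1..2 * n + 1. 6 * int n - 2 * int k + 4 - 2 * int j)
            * (- 1) ^ k * 3 ^ (2 * k + 1))
       + (\<Sum>k = 0..2 * n + 1. int ((2 * n + 1) choose k)
            * (\<Prod>j = 1..2 * n + 1. 6 * int n - 2 * int k + 5 - 2 * int j)
            * (- 1) ^ k * 3 ^ (2 * k)) = 0" (is "?L + ?R = 0")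
proof -
  define m where "m = 2 * n + 1"
  define C where "C = (2 ^ m * fact m :: real)"
  \<comment> \<open>Both sums are multiples of values of \<open>F\<close>; the extra factor 3 in
    \<open>3 ^ (2 * k + 1)\<close> gives the 3 in \<open>3 + sqrt (1 + t)\<close>.\<close>
  define F where "F = (\<lambda>x::real. \<Sum>k\<le>m. of_nat (m choose k) * (-9) ^ k * ((x - of_nat k) gchoose m))"
  have nine: "(-1) ^ k * 3 ^ (2 * k) = (-9 :: real) ^ k" for k
    by (simp add: power_mult flip: power_mult_distrib)
  have P1: "(\<Prod>j = 1..m. 6 * real n - 2 * real k + 4 - 2 * real j)
      = C * ((3 * real n + 1 - real k) gchoose m)" for k
    using prod_even_step_eq_gbinomial[of "3 * real n + 1 - real k" m]
    by (simp add: C_def algebra_simps)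
  have P2: "(\<Prod>j = 1..m. 6 * real n - 2 * real k + 5 - 2 * real j)
      = C * ((3 * real n + 3/2 - real k) gchoose m)" for k
    using prod_even_step_eq_gbinomial[of "3 * real n + 3/2 - real k" m]
    by (simp add: C_def algebra_simps)
  have "real_of_int ?L = (\<Sum>k\<le>m. real (m choose k)
      * (\<Prod>j = 1..m. 6 * real n - 2 * real k + 4 - 2 * real j) * (3 * ((-1) ^ k * 3 ^ (2 * k))))"
    unfolding m_def[symmetric] by (simp add: atLeast0AtMost mult_ac)
  also have "\<dots> = C * (3 * F (3 * real n + 1))"
    unfolding P1 nine F_def sum_distrib_left by (intro sum.cong) (auto simp: mult_ac)
  finally have L: "real_of_int ?L = C * (3 * F (3 * real n + 1))" .
  have "real_of_int ?R = (\<Sum>k\<le>m. real (m choose k)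
      * (\<Prod>j = 1..m. 6 * real n - 2 * real k + 5 - 2 * real j) * ((-1) ^ k * 3 ^ (2 * k)))"
    unfolding m_def[symmetric] by (simp add: atLeast0AtMost mult_ac)
  also have "\<dots> = C * F (3 * real n + 3/2)"
    unfolding P2 nine F_def sum_distrib_left by (intro sum.cong) (auto simp: mult_ac)
  finally have R: "real_of_int ?R = C * F (3 * real n + 3/2)" .
  have base: "1 + fps_X + fps_const (-9) = (fps_X - 8 :: real fps)"
    by (simp add: fps_eq_iff fps_numeral_nth)
  \<comment> \<open>The two exponents of \<open>1 + t\<close> differ by 1/2, whence the square root
    in the second sum.\<close>
  have e1: "3 * real n + 1 - real m = real n" and e2: "3 * real n + 3/2 - real m = real n + 1/2"
    by (simp_all add: m_def)
  have F1: "F (3 * real n + 1) = ((1 + fps_X) ^ n * (fps_X - 8) ^ m) $ m"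
    unfolding F_def sum_binomial_power_gbinomial base e1 fps_binomial_of_nat ..
  have F2: "F (3 * real n + 3/2)
      = ((1 + fps_X) ^ n * (fps_X - 8) ^ m * fps_binomial (1/2)) $ m"
    unfolding F_def sum_binomial_power_gbinomial base e2 fps_binomial_add_mult fps_binomial_of_nat
    by (simp only: mult_ac)
  have "3 * F (3 * real n + 1) + F (3 * real n + 3/2)
      = ((1 + fps_X) ^ n * (fps_X - 8) ^ m * (3 + fps_binomial (1/2 :: real))) $ m"
    unfolding F1 F2 distrib_left by (simp add: numeral_fps_const mult.commute[of _ "fps_const 3"])
  also have "\<dots> = 0" unfolding m_def by (rule fps_sqrt_nth_eq_0)
  finally have "C * (3 * F (3 * real n + 1) + F (3 * real n + 3/2)) = 0" by simp
  hence "real_of_int (?L + ?R) = 0"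
    unfolding of_int_add L R by (simp add: distrib_left)
  thus ?thesis by (simp only: of_int_eq_0_iff)
qed

end
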